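(* Consider the semidefinite program $(\mathrm S)$ defined in the context, with $\Gamma_k^{\mathrm{req}}>0$ and $R_{m,k}^{\max}>0$ for all $k\in\{1,\dots,K\}$, $m\in\{1,\dots,M\}$. Suppose $(\{\mathbf W_k^*\}_{k=1}^K,\mathbf V^*,\{\rho_k^*\}_{k=1}^K)$ is an optimal solution of $(\mathrm S)$. If there exists $k$ with $\mathrm{Rank}(\mathbf W_k^* )>1$, then one can construct another solution $(\{\widetilde{\mathbf W}_k\}_{k=1}^K,\widetilde{\mathbf V},\{\widetilde\rho_k\}_{k=1}^K)$ of $(\mathrm S)$, i.e. a feasible point of $(\mathrm S)$, which achieves the same objective value as $(\{\mathbf W_k^*\},\mathbf V^*,\{\rho_k^*\})$ and satisfies $\mathrm{Rank}(\widetilde{\mathbf W}_k)=1$ for all $k$.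
   Context: Notation: $\mathbb H^{N}$ is the set of $N\times N$ complex Hermitian matrices; $\succeq,\preceq$ denote the positive semidefinite order; $(\cdot)^H$ is the conjugate transpose; $\mathbf I_N$ is the $N\times N$ identity. Data: integers $K,M\ge1$ and $N_{\mathrm T}>N_{\mathrm R}\ge1$; vectors $\mathbf h_k\in\mathbb C^{N_{\mathrm T}}$ ($k=1,\dots,K$); matrices $\mathbf G_m\in\mathbb C^{N_{\mathrm T}\times N_{\mathrm R}}$ ($m=1,\dots,M$); real constants $\sigma_{\mathrm{ant}}^2,\sigma_{\mathrm s}^2>0$, $\eta\in(0,1]$, $P_k^{\mathrm{req1}},P_m^{\mathrm{req2}}\ge0$, $\Gamma_k^{\mathrm{req}}$, $R_{m,k}^{\max}$; and $\psi_{m,k}=2^{R_{m,k}^{\max}}$. Problem $(\mathrm S)$: minimize $$\sum_{k=1}^K\mathrm{Tr}(\mathbf W_k)+\mathrm{Tr}(\mathbf V)$$ over $\mathbf W_1,\dots,\mathbf W_K,\mathbf V\in\mathbb H^{N_{\mathrm T}}$ and $\rho_1,\dots,\rho_K\in\mathbb R$ subject to, for all $k\in\{1,\dots,K\}$ and $m\in\{1,\dots,M\}$: - C1: $\dfrac{1}{\Gamma_k^{\mathrm{req}}}\mathrm{Tr}(\mathbf h_k\mathbf h_k^H\mathbf W_k)-\sum_{j\ne k}\mathrm{Tr}(\mathbf h_k\mathbf h_k^H\mathbf W_j)-\mathrm{Tr}(\mathbf h_k\mathbf h_k^H\mathbf V)\ge\sigma_{\mathrm{ant}}^2+\dfrac{\sigma_{\mathrm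 s}^2}{\rho_k}$; - C2: $\mathbf G_m^H\mathbf W_k\mathbf G_m\preceq(\psi_{m,k}-1)\mathbf Q_m$, where $\mathbf Q_m=\mathbf G_m^H\mathbf V\mathbf G_m+(\sigma_{\mathrm{ant}}^2+\sigma_{\mathrm s}^2)\mathbf I_{N_{\mathrm R}}$; - C3: $\mathrm{Tr}\big(\mathbf h_k\mathbf h_k^H(\mathbf V+\sum_{j=1}^K\mathbf W_j)\big)\ge\dfrac{P_k^{\mathrm{req1}}}{\eta(1-\rho_k)}-\sigma_{\mathrm{ant}}^2$; - C4: $\mathrm{Tr}\big(\mathbf G_m^H(\mathbf V+\sum_{j=1}^K\mathbf W_j)\mathbf G_m\big)\ge\dfrac{P_m^{\mathrm{req2}}}{\eta}-N_{\mathrm R}\sigma_{\mathrm{ant}}^2$; - C5: $0\le\rho_k\le1$; - C6: $\mathbf V\succeq\mathbf 0$; - C7: $\mathbf W_k\succeq\mathbf 0$. Conventions: $c/0=+\infty$ for $c>0$ (so a point with $\rho_k=0$ violates C1, and one with $\rho_k=1$ violates C3 when $P_k^{\mathrm{req1}}>0$), and $0/0=0$. *)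

theory Defs
  imports "HOL-Analysis.Analysis"
begin

definition ctranspose :: "complex^'n^'m \<Rightarrow> complex^'m^'n" where
  "ctranspose A = (\<chi> i j. cnj (A $ j $ i))"

definition hermitian :: "complex^'n^'n \<Rightarrow> bool" where
  "hermitian A \<longleftrightarrow> ctranspose A = A"

text \<open>For Hermitian \<open>A\<close> the number \<open>x\<^sup>H A x\<close> is real, so \<open>Re\<close> loses nothing.\<close>

definition psd :: "complex^'n^'n \<Rightarrow> bool" where
  "psd A \<longleftrightarrow> hermitian A \<and> (\<forall>x. 0 \<le> Re (\<Sum>i\<in>UNIV. cnj (x $ i) * (A *v x) $ i))"

definition loewner_le :: "complex^'n^'n \<Rightarrow> complex^'n^'n \<Rightarrow> bool" (infix "\<preceq>\<^sub>L" 50) where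
  "A \<preceq>\<^sub>L B \<longleftrightarrow> psd (B - A)"

text \<open>The rank-one matrix \<open>h h\<^sup>H\<close>.\<close>

definition outer :: "complex^'n \<Rightarrow> complex^'n^'n" where
  "outer h = (\<chi> i j. h $ i * cnj (h $ j))"

text \<open>
  Every trace occurring in the problem is that of a Hermitian matrix, or of a product of two
  Hermitian matrices, and is therefore real.
\<close>

abbreviation Tr :: "complex^'n^'n \<Rightarrow> real" where
  "Tr A \<equiv> Re (trace A)"

text \<open>
  Problem data. The dimensions \<open>N\<^sub>T\<close> and \<open>N\<^sub>R\<close> are the cardinalities of the index types \<open>'t\<close>
  and \<open>'r\<close>; the indices \<open>k\<close> and \<open>m\<close> range over \<open>{1..num_K}\<close> and \<open>{1..num_M}\<close>. The fields
  \<open>sig_ant2\<close> and \<open>sig_s2\<close> are the variances (that is, the squares) themselves.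
\<close>

record ('t, 'r) sdp_data =
  num_K :: nat
  num_M :: nat
  chan_h :: "nat \<Rightarrow> complex^'t"
  chan_G :: "nat \<Rightarrow> complex^'r^'t"
  sig_ant2 :: real
  sig_s2 :: real
  eff :: real
  P_req1 :: "nat \<Rightarrow> real"
  P_req2 :: "nat \<Rightarrow> real"
  Gam_req :: "nat \<Rightarrow> real"
  R_max :: "nat \<Rightarrow> nat \<Rightarrow> real"

definition psi :: "('t::finite, 'r::finite) sdp_data \<Rightarrow> nat \<Rightarrow> nat \<Rightarrow> real" where
  "psi D m k = 2 powr R_max D m k"

definition Q_mat ::
    "('t::finite, 'r::finite) sdp_data \<Rightarrow> complex^'t^'t \<Rightarrow> nat \<Rightarrow> complex^'r^'r" where
  "Q_mat D V m =
     ctranspose (chan_G D m) ** V ** chan_G D m + (sig_ant2 D + sig_s2 D) *\<^sub>R mat 1"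

text \<open>
  The quotients in \<open>C1\<close> and \<open>C3\<close> are taken in \<^typ>\<open>ereal\<close>, where \<open>c / 0 = \<infinity>\<close> for \<open>c > 0\<close>
  and \<open>0 / 0 = 0\<close>; on \<^typ>\<open>real\<close>, division by zero would instead give \<open>0\<close> and
  wrongly admit points with \<open>\<rho> k = 0\<close> or \<open>\<rho> k = 1\<close>.
\<close>

lemma ereal_quotient_conventions:
  "0 < c \<Longrightarrow> ereal c / ereal 0 = \<infinity>"
  "ereal 0 / ereal 0 = 0"
  "x \<noteq> 0 \<Longrightarrow> ereal c / ereal x = ereal (c / x)"
  by (simp_all add: divide_ereal_def divide_real_def)

definition C1 ::
    "('t::finite, 'r::finite) sdp_data \<Rightarrow> (nat \<Rightarrow> complex^'t^'t) \<Rightarrow> complex^'t^'t \<Rightarrow> (nat \<Rightarrow> real) \<Rightarrow>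
     nat \<Rightarrow> bool" where
  "C1 D W V \<rho> k \<longleftrightarrow>
     ereal (1 / Gam_req D k * Tr (outer (chan_h D k) ** W k)
            - (\<Sum>j\<in>{1..num_K D} - {k}. Tr (outer (chan_h D k) ** W j))
            - Tr (outer (chan_h D k) ** V))
     \<ge> ereal (sig_ant2 D) + ereal (sig_s2 D) / ereal (\<rho> k)"

definition C2 ::
    "('t::finite, 'r::finite) sdp_data \<Rightarrow> (nat \<Rightarrow> complex^'t^'t) \<Rightarrow> complex^'t^'t \<Rightarrow>
     nat \<Rightarrow> nat \<Rightarrow> bool" where
  "C2 D W V m k \<longleftrightarrow>
     ctranspose (chan_G D m) ** W k ** chan_G D m \<preceq>\<^sub>L (psi D m k - 1) *\<^sub>R Q_mat D V m"

definition C3 ::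
    "('t::finite, 'r::finite) sdp_data \<Rightarrow> (nat \<Rightarrow> complex^'t^'t) \<Rightarrow> complex^'t^'t \<Rightarrow> (nat \<Rightarrow> real) \<Rightarrow>
     nat \<Rightarrow> bool" where
  "C3 D W V \<rho> k \<longleftrightarrow>
     ereal (Tr (outer (chan_h D k) ** (V + (\<Sum>j\<in>{1..num_K D}. W j))))
     \<ge> ereal (P_req1 D k) / ereal (eff D * (1 - \<rho> k)) - ereal (sig_ant2 D)"

definition C4 ::
    "('t::finite, 'r::finite) sdp_data \<Rightarrow> (nat \<Rightarrow> complex^'t^'t) \<Rightarrow> complex^'t^'t \<Rightarrow> nat \<Rightarrow> bool" where
  "C4 D W V m \<longleftrightarrow>
     Tr (ctranspose (chan_G D m) ** (V + (\<Sum>j\<in>{1..num_K D}. W j)) ** chan_G D m)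
     \<ge> P_req2 D m / eff D - real CARD('r) * sig_ant2 D"

definition feasible ::
    "('t::finite, 'r::finite) sdp_data \<Rightarrow> (nat \<Rightarrow> complex^'t^'t) \<Rightarrow> complex^'t^'t \<Rightarrow> (nat \<Rightarrow> real) \<Rightarrow>
     bool" where
  "feasible D W V \<rho> \<longleftrightarrow>
     (\<forall>k\<in>{1..num_K D}. hermitian (W k)) \<and> hermitian V \<and>
     (\<forall>k\<in>{1..num_K D}. C1 D W V \<rho> k) \<and>
     (\<forall>k\<in>{1..num_K D}. \<forall>m\<in>{1..num_M D}. C2 D W V m k) \<and>
     (\<forall>k\<in>{1..num_K D}. C3 D W V \<rho> k) \<and>
     (\<forall>m\<in>{1..num_M D}. C4 D W V m) \<and>
     (\<forall>k\<in>{1..num_K D}. 0 \<le> \<rho> k \<and> \<rho> k \<le> 1) \<and>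
     psd V \<and>
     (\<forall>k\<in>{1..num_K D}. psd (W k))"

definition objective ::
    "('t::finite, 'r::finite) sdp_data \<Rightarrow> (nat \<Rightarrow> complex^'t^'t) \<Rightarrow> complex^'t^'t \<Rightarrow> real" where
  "objective D W V = (\<Sum>k\<in>{1..num_K D}. Tr (W k)) + Tr V"

definition optimal ::
    "('t::finite, 'r::finite) sdp_data \<Rightarrow> (nat \<Rightarrow> complex^'t^'t) \<Rightarrow> complex^'t^'t \<Rightarrow> (nat \<Rightarrow> real) \<Rightarrow>
     bool" where
  "optimal D W V \<rho> \<longleftrightarrow>
     feasible D W V \<rho> \<and>
     (\<forall>W' V' \<rho>'. feasible D W' V' \<rho>' \<longrightarrow> objective D W V \<le> objective D W' V')"

end

theory Submission
  imports Defs
begin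

text \<open>
  Replace each \<open>W\<^sub>k\<close> by its compression \<open>W\<^sub>k h\<^sub>k h\<^sub>k\<^sup>H W\<^sub>k / (h\<^sub>k\<^sup>H W\<^sub>k h\<^sub>k)\<close>, which has rank one because
  \<open>C1\<close> forces \<open>h\<^sub>k\<^sup>H W\<^sub>k h\<^sub>k > 0\<close>, and move the remainder into \<open>V\<close>. By the Cauchy--Schwarz inequality
  for \<open>W\<^sub>k\<close> the remainder is positive semidefinite, so \<open>V\<close> grows and \<open>W\<^sub>k\<close> shrinks, which preserves
  \<open>C2\<close>. The sum \<open>V + \<Sum>\<^sub>j W\<^sub>j\<close> and the numbers \<open>h\<^sub>k\<^sup>H W\<^sub>k h\<^sub>k\<close> do not change, and all other
  constraints and the objective depend on these alone.
\<close>

section \<open>The complex inner product\<close>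

text \<open>Conjugate-linear in the first argument, so that the quadratic form in \<open>psd\<close>
  is \<open>cip x (A *v x)\<close>.\<close>

definition cip :: "complex^'n \<Rightarrow> complex^'n \<Rightarrow> complex" where
  "cip x y = (\<Sum>i\<in>UNIV. cnj (x $ i) * y $ i)"

lemma cip_add_right: "cip x (y + z) = cip x y + cip x z"
  by (simp add: cip_def algebra_simps sum.distrib)

lemma cip_diff_right: "cip x (y - z) = cip x y - cip x z"
  by (simp add: cip_def algebra_simps sum_subtractf)

lemma cip_diff_left: "cip (x - y) z = cip x z - cip y z"
  by (simp add: cip_def algebra_simps sum_subtractf)

lemma cip_scale_right: "cip x (c *s y) = c * cip x y"
  by (simp add: cip_def sum_distrib_left mult_ac)

lemma cip_scale_left: "cip (c *s x) y = cnj c * cip x y"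
  by (simp add: cip_def sum_distrib_left mult_ac)

lemma cip_scaleR_left: "cip (c *\<^sub>R x) y = of_real c * cip x y"
  by (simp add: cip_def sum_distrib_left mult_ac scaleR_conv_of_real[where 'a=complex])

lemma cip_scaleR_right: "cip x (c *\<^sub>R y) = of_real c * cip x y"
  by (simp add: cip_def sum_distrib_left mult_ac scaleR_conv_of_real[where 'a=complex])

lemma cnj_cip: "cnj (cip x y) = cip y x"
  by (simp add: cip_def mult_ac)

lemma cip_matrix_right: "cip x (A *v y) = cip (ctranspose A *v x) y"
proof -
  have "cip x (A *v y) = (\<Sum>i\<in>UNIV. \<Sum>j\<in>UNIV. cnj (x $ i) * (A $ i $ j * y $ j))"
    by (simp add: cip_def matrix_vector_mult_def sum_distrib_left)
  also have "\<dots> = (\<Sum>j\<in>UNIV. \<Sum>i\<in>UNIV. cnj (x $ i) * (A $ i $ j * y $ j))"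
    by (rule sum.swap)
  also have "\<dots> = cip (ctranspose A *v x) y"
    by (simp add: cip_def matrix_vector_mult_def ctranspose_def sum_distrib_left sum_distrib_right mult_ac)
  finally show ?thesis .
qed

lemma outer_mult_vector: "outer u *v x = cip u x *s u"
  by (simp add: vec_eq_iff outer_def matrix_vector_mult_def cip_def sum_distrib_left mult_ac)

text \<open>Turns the traces in \<open>C1\<close> into quadratic forms evaluated at the channel
  vector.\<close>

lemma trace_outer_mult: "trace (outer u ** A) = cip u (A *v u)"
proof -
  have "trace (outer u ** A) = (\<Sum>i\<in>UNIV. \<Sum>j\<in>UNIV. u $ i * cnj (u $ j) * A $ j $ i)"
    by (simp add: trace_def outer_def matrix_matrix_mult_def)
  also have "\<dots> = (\<Sum>j\<in>UNIV. \<Sum>i\<in>UNIV. u $ i * cnj (u $ j) * A $ j $ i)"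
    by (rule sum.swap)
  also have "\<dots> = cip u (A *v u)"
    by (simp add: cip_def matrix_vector_mult_def sum_distrib_left mult_ac)
  finally show ?thesis .
qed

lemma scaleR_matrix_mult_vector:
  "(c *\<^sub>R A) *v (x :: complex^'n) = c *\<^sub>R (A *v x)"
  by (simp add: vec_eq_iff matrix_vector_mult_def scaleR_sum_right)

section \<open>The cone of positive semidefinite matrices\<close>

lemma psd_iff_cip: "psd A \<longleftrightarrow> hermitian A \<and> (\<forall>x. 0 \<le> Re (cip x (A *v x)))"
  by (simp add: psd_def cip_def)

lemma psd_zero: "psd 0"
  by (simp add: psd_def hermitian_def ctranspose_def vec_eq_iff)

lemma psd_add: "psd A \<Longrightarrow> psd B \<Longrightarrow> psd (A + B)"
  by (auto simp: psd_iff_cip hermitian_def ctranspose_def vec_eq_iff matrix_vector_mult_add_rdistrib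
      cip_add_right)

lemma psd_sum: "(\<And>i. i \<in> S \<Longrightarrow> psd (f i)) \<Longrightarrow> psd (\<Sum>i\<in>S. f i)"
  by (induction S rule: infinite_finite_induct) (auto simp: psd_zero psd_add)

lemma psd_scaleR: "psd A \<Longrightarrow> 0 \<le> c \<Longrightarrow> psd (c *\<^sub>R A)"
  by (auto simp: psd_iff_cip hermitian_def ctranspose_def vec_eq_iff scaleR_matrix_mult_vector
      cip_scaleR_right)

lemma ctranspose_mult: "ctranspose (A ** B) = ctranspose B ** ctranspose A"
  by (simp add: ctranspose_def matrix_matrix_mult_def vec_eq_iff mult_ac)

lemma ctranspose_ctranspose [simp]: "ctranspose (ctranspose A) = A"
  by (simp add: ctranspose_def vec_eq_iff)

text \<open>The form of the congruent matrix at \<open>x\<close> is the form of \<open>A\<close> at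
  \<open>G *v x\<close>.\<close>

lemma psd_congruence: "psd A \<Longrightarrow> psd (ctranspose G ** A ** G)"
  by (auto simp: psd_iff_cip hermitian_def ctranspose_mult matrix_mul_assoc
      cip_matrix_right[of _ "ctranspose G"]
      simp flip: matrix_vector_mul_assoc)

section \<open>Rank-one matrices\<close>

lemma psd_outer: "psd (outer u)"
proof -
  have "0 \<le> Re (cip x (outer u *v x))" for x
    by (simp add: outer_mult_vector cip_scale_right flip: cnj_cip[of u x])
  then show ?thesis
    by (simp add: psd_iff_cip hermitian_def ctranspose_def outer_def vec_eq_iff mult_ac)
qed

text \<open>Each row is a multiple of the entrywise conjugate \<open>v\<close> of \<open>u\<close>,
  and a row at a nonzero entry of \<open>u\<close> gives \<open>v\<close> back, so the row space is
  the line through \<open>v\<close>.\<close>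

lemma rank_outer:
  assumes "u \<noteq> 0"
  shows "rank (outer u) = 1"
proof -
  define v :: "complex^'a" where "v = (\<chi> j. cnj (u $ j))"
  have "v \<noteq> 0"
    using assms by (simp add: v_def vec_eq_iff)
  have row: "row i (outer u) = u $ i *s v" for i
    by (simp add: row_def outer_def v_def vec_eq_iff)
  obtain i where i: "u $ i \<noteq> 0"
    using assms by (auto simp: vec_eq_iff)
  have "rows (outer u) \<subseteq> vec.span {v}"
    by (auto simp: rows_def row vec.span_base vec.span_scale)
  moreover have "v = inverse (u $ i) *s row i (outer u)"
    using i by (simp add: row)
  then have "{v} \<subseteq> vec.span (rows (outer u))"
    by (metis (mono_tags, lifting) UNIV_I empty_subsetI insert_subset mem_Collect_eq rows_def
        vec.span_base vec.span_scale)
  ultimately have "vec.dim (rows (outer u)) = vec.dim {v}"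
    by (metis order_antisym vec.dim_span vec.span_minimal vec.subspace_span)
  also have "\<dots> = 1"
    using \<open>v \<noteq> 0\<close> by (simp add: vec.dim_eq_card_independent)
  finally show ?thesis
    by (simp add: row_rank_def_gen)
qed

section \<open>Rank-one compression of a positive semidefinite matrix\<close>

text \<open>
  The compression \<open>W h h\<^sup>H W / (h\<^sup>H W h)\<close> written as \<open>w w\<^sup>H\<close>; junk unless \<open>h\<^sup>H W h > 0\<close>.
\<close>

definition compress_vec :: "complex^'n^'n \<Rightarrow> complex^'n \<Rightarrow> complex^'n" where
  "compress_vec W h = (1 / sqrt (Re (cip h (W *v h)))) *\<^sub>R (W *v h)"

lemma hermitian_cip: "hermitian A \<Longrightarrow> cip x (A *v y) = cip (A *v x) y"
  by (simp add: cip_matrix_right hermitian_def)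

lemma hermitian_cip_self:
  assumes "hermitian A"
  shows "cip x (A *v x) = of_real (Re (cip x (A *v x)))"
proof -
  have "cnj (cip x (A *v x)) = cip x (A *v x)"
    using assms by (simp add: cnj_cip flip: hermitian_cip)
  then show ?thesis
    by (simp add: complex_eq_iff)
qed

context
  fixes W :: "complex^'n^'n" and h :: "complex^'n"
  assumes psd_W: "psd W" and pos: "0 < Re (cip h (W *v h))"
begin

text \<open>The form of \<open>outer w\<close> at \<open>x\<close> is the squared modulus of
  \<open>cip w x\<close>; since \<open>W\<close> is Hermitian, it can be moved from \<open>h\<close>
  to \<open>x\<close>.\<close>

lemma cip_outer_compress_vec:
  "cip x (outer (compress_vec W h) *v x) = of_real ((cmod (cip h (W *v x)))\<^sup>2 / Re (cip h (W *v h)))"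
proof -
  define a where "a = Re (cip h (W *v h))"
  define z where "z = cip h (W *v x)"
  have sqrt_a: "complex_of_real (sqrt a) * complex_of_real (sqrt a) = of_real a"
    using pos by (simp add: a_def flip: of_real_mult)
  have w: "cip (compress_vec W h) x = of_real (1 / sqrt a) * z"
    using psd_W by (simp add: compress_vec_def cip_scaleR_left a_def z_def hermitian_cip psd_def)
  have "cip x (outer (compress_vec W h) *v x)
      = (of_real (1 / sqrt a) * z) * cnj (of_real (1 / sqrt a) * z)"
    by (simp only: outer_mult_vector cip_scale_right cnj_cip[of "compress_vec W h" x, symmetric] w)
  also have "\<dots> = z * cnj z / (of_real (sqrt a) * of_real (sqrt a))"
    by simp
  also have "\<dots> = of_real ((cmod z)\<^sup>2 / a)"
    unfolding sqrt_a by (simp flip: complex_norm_square)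
  finally show ?thesis
    by (simp add: a_def z_def)
qed

text \<open>At \<open>x = h\<close> the numerator is the square of the denominator. This keeps the
  signal term of \<open>C1\<close> unchanged.\<close>

lemma cip_outer_compress_vec_self:
  "cip h (outer (compress_vec W h) *v h) = cip h (W *v h)"
proof -
  have "(cmod (cip h (W *v h)))\<^sup>2 = (Re (cip h (W *v h)))\<^sup>2"
    using hermitian_cip_self[of W h] psd_W by (metis norm_of_real power2_abs psd_def)
  then show ?thesis
    using hermitian_cip_self[of W h] psd_W pos
    by (simp add: cip_outer_compress_vec power2_eq_square psd_def)
qed

text \<open>Cauchy--Schwarz: evaluate the form at the component of \<open>x\<close> that is \<open>W\<close>-orthogonal to \<open>h\<close>.\<close>

lemma psd_diff_outer_compress_vec: "psd (W - outer (compress_vec W h))"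
proof -
  have herm: "hermitian W"
    using psd_W by (simp add: psd_def)
  define a where "a = Re (cip h (W *v h))"
  have a: "cip h (W *v h) = of_real a" "0 < a"
    using herm pos hermitian_cip_self by (auto simp: a_def)
  have "0 \<le> Re (cip x ((W - outer (compress_vec W h)) *v x))" for x
  proof -
    define z where "z = cip h (W *v x)"
    \<comment> \<open>The choice that solves
      \<open>cip h (W *v (x - c *s h)) = z - c * of_real a = 0\<close>.\<close>
    define c where "c = z / of_real a"
    have xh: "cip x (W *v h) = cnj z"
      using herm by (simp add: z_def cnj_cip hermitian_cip)
    have "cip (x - c *s h) (W *v (x - c *s h))
        = cip x (W *v x) - c * cnj z - cnj c * z + cnj c * c * of_real a"
      by (simp add: matrix_vector_mult_diff_distrib vector_scalar_commute cip_diff_left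
          cip_diff_right cip_scale_left cip_scale_right a xh z_def algebra_simps)
    also have "\<dots> = cip x (W *v x) - z * cnj z / of_real a"
      using a(2) by (simp add: c_def field_simps)
    also have "\<dots> = cip x (W *v x) - of_real ((cmod z)\<^sup>2 / a)"
      by (simp flip: complex_norm_square)
    finally have "cip x ((W - outer (compress_vec W h)) *v x)
        = cip (x - c *s h) (W *v (x - c *s h))"
      by (simp add: matrix_vector_mult_diff_rdistrib cip_diff_right cip_outer_compress_vec z_def a_def)
    then show ?thesis
      using psd_W by (simp add: psd_iff_cip)
  qed
  moreover have "hermitian (W - outer (compress_vec W h))"
    using herm by (simp add: hermitian_def ctranspose_def outer_def vec_eq_iff mult_ac)
  ultimately show ?thesis
    by (simp add: psd_iff_cip)
qed

lemma rank_outer_compress_vec: "rank (outer (compress_vec W h)) = 1"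
proof (rule rank_outer)
  show "compress_vec W h \<noteq> 0"
    \<comment> \<open>If \<open>W *v h\<close> were zero, \<open>cip h (W *v h)\<close> would be
      zero too.\<close>
    using pos by (auto simp: compress_vec_def cip_def)
qed

end

section \<open>Positive signal power and linearity of the trace\<close>

lemma Tr_outer_mult_nonneg: "psd A \<Longrightarrow> 0 \<le> Tr (outer h ** A)"
  by (simp add: trace_outer_mult psd_iff_cip)

text \<open>The right side of \<open>C1\<close> is at least \<open>sig_ant2 D > 0\<close>, while
  interference and \<open>V\<close> only lower the left side, so the signal term must be
  positive.\<close>

lemma C1_signal_pos:
  assumes "C1 D W V \<rho> k" "\<forall>j\<in>{1..num_K D}. psd (W j)" "psd V"
    and "0 \<le> \<rho> k" "0 < sig_ant2 D" "0 < sig_s2 D" "0 < Gam_req D k"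
  shows "0 < Re (cip (chan_h D k) (W k *v chan_h D k))"
proof -
  define T where "T A = Tr (outer (chan_h D k) ** A)" for A
  \<comment> \<open>At \<open>\<rho> k = 0\<close> the quotient is \<open>\<infinity>\<close>, so
    the bound covers that endpoint as well.\<close>
  have "0 \<le> ereal (sig_s2 D) / ereal (\<rho> k)"
    using assms by (cases "\<rho> k = 0") (simp_all add: ereal_quotient_conventions)
  then have "ereal (sig_ant2 D) \<le> ereal (sig_ant2 D) + ereal (sig_s2 D) / ereal (\<rho> k)"
    by (simp add: ereal_le_add_self)
  also have "\<dots> \<le> ereal (1 / Gam_req D k * T (W k) - (\<Sum>j\<in>{1..num_K D} - {k}. T (W j)) - T V)"
    using assms(1) by (simp only: C1_def T_def)
  finally have "sig_ant2 D \<le> 1 / Gam_req D k * T (W k) - (\<Sum>j\<in>{1..num_K D} - {k}. T (W j)) - T V"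
    by simp
  moreover have "0 \<le> (\<Sum>j\<in>{1..num_K D} - {k}. T (W j))" "0 \<le> T V"
    using assms by (auto simp: T_def Tr_outer_mult_nonneg intro!: sum_nonneg)
  ultimately have "0 < 1 / Gam_req D k * T (W k)"
    using assms by linarith
  then show ?thesis
    using assms by (simp add: T_def trace_outer_mult zero_less_divide_iff)
qed

lemma Tr_mult_sum_right: "Tr (A ** (\<Sum>j\<in>S. f j)) = (\<Sum>j\<in>S. Tr (A ** f j))"
  by (induction S rule: infinite_finite_induct) (simp_all add: matrix_add_ldistrib trace_add trace_0[unfolded mat_0])

lemma Tr_sum: "Tr (\<Sum>j\<in>S. f j) = (\<Sum>j\<in>S. Tr (f j))"
  using Tr_mult_sum_right[of "mat 1"] by simp

lemma congruence_diff:
  fixes A B :: "complex^'n^'n"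
  shows "ctranspose G ** (A - B) ** G = ctranspose G ** A ** G - ctranspose G ** B ** G"
  by (simp add: vec_eq_iff matrix_matrix_mult_def algebra_simps sum_subtractf)

theorem theorem2:
  fixes D :: "('t::finite, 'r::finite) sdp_data"
    and W :: "nat \<Rightarrow> complex^'t^'t" and V :: "complex^'t^'t" and \<rho> :: "nat \<Rightarrow> real"
  assumes "num_K D \<ge> 1" and "num_M D \<ge> 1"
    and "CARD('t) > CARD('r)"
    and "sig_ant2 D > 0" and "sig_s2 D > 0"
    and "0 < eff D" and "eff D \<le> 1"
    and "\<forall>k\<in>{1..num_K D}. P_req1 D k \<ge> 0"
    and "\<forall>m\<in>{1..num_M D}. P_req2 D m \<ge> 0"
    and "\<forall>k\<in>{1..num_K D}. Gam_req D k > 0"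
    and "\<forall>m\<in>{1..num_M D}. \<forall>k\<in>{1..num_K D}. R_max D m k > 0"
    and "optimal D W V \<rho>"
    and "\<exists>k\<in>{1..num_K D}. rank (W k) > 1"
  shows "\<exists>W' V' \<rho>'.
    feasible D W' V' \<rho>' \<and>
    objective D W' V' = objective D W V \<and>
    (\<forall>k\<in>{1..num_K D}. rank (W' k) = 1)"
proof -
  let ?S = "{1..num_K D}"
  have feas: "feasible D W V \<rho>"
    using assms by (simp add: optimal_def)
  define W' where "W' k = outer (compress_vec (W k) (chan_h D k))" for k
  define V' where "V' = V + (\<Sum>k\<in>?S. W k - W' k)"
  have psd_W: "psd (W k)" if "k \<in> ?S" for k
    using feas that by (simp add: feasible_def)
  have psd_V: "psd V"
    using feas by (simp add: feasible_def)
  have pos: "0 < Re (cip (chan_h D k) (W k *v chan_h D k))" if "k \<in> ?S" for k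
    by (rule C1_signal_pos) (use feas assms that in \<open>auto simp: feasible_def\<close>)
  have psd_diff: "psd (W k - W' k)" if "k \<in> ?S" for k
    unfolding W'_def by (rule psd_diff_outer_compress_vec) (use psd_W pos that in auto)
  have psd_sum_diff: "psd (V' - V)"
    unfolding V'_def by (simp only: add_diff_cancel_left') (intro psd_sum psd_diff)
  have psd_V': "psd V'"
    unfolding V'_def by (intro psd_add psd_V psd_sum psd_diff)
  have psd_W': "psd (W' k)" for k
    by (simp add: W'_def psd_outer)
  have total: "V' + (\<Sum>j\<in>?S. W' j) = V + (\<Sum>j\<in>?S. W j)"
    by (simp add: V'_def sum_subtractf)
  have "C1 D W' V' \<rho> k" if k: "k \<in> ?S" for k
  proof -
    define T where "T A = Tr (outer (chan_h D k) ** A)" for A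
    have T_add: "T (A + B) = T A + T B" and T_sum: "T (\<Sum>j\<in>S. f j) = (\<Sum>j\<in>S. T (f j))"
      for A B and f :: "nat \<Rightarrow> complex^'t^'t" and S
      by (simp_all add: T_def matrix_add_ldistrib trace_add Tr_mult_sum_right)
    have Tk: "T (W' k) = T (W k)"
      using cip_outer_compress_vec_self[OF psd_W[OF k] pos[OF k]]
      by (simp add: T_def W'_def trace_outer_mult)
    have "T V' + (\<Sum>j\<in>?S. T (W' j)) = T V + (\<Sum>j\<in>?S. T (W j))"
      using arg_cong[OF total, of T] by (simp add: T_add T_sum)
    \<comment> \<open>Removing the equal \<open>k\<close>-th terms from both totals shows that what
      \<open>V'\<close> gains at \<open>chan_h D k\<close> is exactly what the interfering
      \<open>W' j\<close> lose.\<close>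
    then have "(\<Sum>j\<in>?S - {k}. T (W' j)) + T V' = (\<Sum>j\<in>?S - {k}. T (W j)) + T V"
      using Tk sum.remove[OF _ k, of "\<lambda>j. T (W j)"]
        sum.remove[OF _ k, of "\<lambda>j. T (W' j)"]
      by simp
    then have "1 / Gam_req D k * T (W' k) - (\<Sum>j\<in>?S - {k}. T (W' j)) - T V'
        = 1 / Gam_req D k * T (W k) - (\<Sum>j\<in>?S - {k}. T (W j)) - T V"
      using Tk by simp
    moreover have "C1 D W V \<rho> k"
      using feas k by (simp add: feasible_def)
    ultimately show ?thesis
      by (simp only: C1_def T_def)
  qed
  moreover have "C2 D W' V' m k" if k: "k \<in> ?S" and m: "m \<in> {1..num_M D}" for k m
  proof -
    let ?G = "chan_G D m"
    \<comment> \<open>A positive rate gives \<open>psi D m k \<ge> 1\<close>, so scaling by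
      \<open>psi D m k - 1\<close> preserves semidefiniteness.\<close>
    have psi: "0 \<le> psi D m k - 1"
      using assms k m by (simp add: psi_def ge_one_powr_ge_zero less_imp_le)
    have "C2 D W V m k"
      using feas k m by (simp add: feasible_def)
    then have "psd ((psi D m k - 1) *\<^sub>R Q_mat D V m - ctranspose ?G ** W k ** ?G)"
      by (simp add: C2_def loewner_le_def)
    moreover have "psd ((psi D m k - 1) *\<^sub>R (ctranspose ?G ** (V' - V) ** ?G))"
      by (intro psd_scaleR psd_congruence psd_sum_diff psi)
    moreover have "psd (ctranspose ?G ** (W k - W' k) ** ?G)"
      by (intro psd_congruence psd_diff k)
    \<comment> \<open>The new slack of \<open>C2\<close> is the old slack, plus the growth of
      \<open>V\<close> seen through \<open>?G\<close>, plus the part removed from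
      \<open>W k\<close>; the noise term of \<open>Q_mat\<close> is the same for \<open>V\<close>
      and \<open>V'\<close>.\<close>
    ultimately have "psd (((psi D m k - 1) *\<^sub>R Q_mat D V m - ctranspose ?G ** W k ** ?G)
        + (psi D m k - 1) *\<^sub>R (ctranspose ?G ** (V' - V) ** ?G)
        + ctranspose ?G ** (W k - W' k) ** ?G)"
      by (intro psd_add)
    also have "((psi D m k - 1) *\<^sub>R Q_mat D V m - ctranspose ?G ** W k ** ?G)
        + (psi D m k - 1) *\<^sub>R (ctranspose ?G ** (V' - V) ** ?G)
        + ctranspose ?G ** (W k - W' k) ** ?G
        = (psi D m k - 1) *\<^sub>R Q_mat D V' m - ctranspose ?G ** W' k ** ?G"
      by (simp add: congruence_diff Q_mat_def scaleR_add_right scaleR_diff_right)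
    finally show ?thesis
      by (simp add: C2_def loewner_le_def)
  qed
  \<comment> \<open>With \<open>\<rho>\<close> kept, rewriting by \<open>total\<close> turns
    \<open>C3\<close>, and then \<open>C4\<close>, into the old constraint.\<close>
  moreover have "C3 D W' V' \<rho> k" if "k \<in> ?S" for k
    using feas that unfolding feasible_def C3_def total by blast
  moreover have "C4 D W' V' m" if "m \<in> {1..num_M D}" for m
    using feas that unfolding feasible_def C4_def total by blast
  ultimately have "feasible D W' V' \<rho>"
    using feas psd_V' psd_W' by (simp add: feasible_def psd_def)
  moreover have "objective D W' V' = objective D W V"
    using arg_cong[OF total, of Tr] by (simp add: objective_def trace_add Tr_sum)
  moreover have "rank (W' k) = 1" if "k \<in> ?S" for k
    unfolding W'_def by (rule rank_outer_compress_vec) (use psd_W pos that in auto)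
  ultimately show ?thesis
    by blast
qed

end
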